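(* The following equalities hold: \[\psi(Met_{n+1})=\psi(dWMet_n)=WQMet_n\quad\mbox{and}\quad WQMet_n^*=WQMet_n.\]
   Context: Let $V$ be a finite set with $|V|=n$ and let $0\notin V$. Let $E$ be the set of unordered pairs $(ij)$ of distinct elements of $V$, $E_0=\{(0i):i\in V\}$, and $E^{\cal O}$ the set of ordered pairs $ij$ of distinct elements of $V$. The Euclidean spaces ${\mathbb R}^{E\cup E_0}$ and ${\mathbb R}^{E^{\cal O}}$ have orthonormal bases $\{e_{(ij)}\}\cup\{e_{(0i)}\}$ and $\{e_{ij}\}$, respectively. $Met_{n+1}\subset{\mathbb R}^{E\cup E_0}$ is the cone of semi-metrics on $V\cup\{0\}$, i.e. all $d$ with $d_{(ij)}+d_{(jk)}-d_{(ik)}\ge0$ for all distinct $i,j,k\in V\cup\{0\}$. The cone $dWMet_n\subset{\mathbb R}^{E\cup E_0}$ of down-weighted metrics consists of all $d$ such that $d_{(ik)}+d_{(kj)}-d_{(ij)}\ge0$ for all distinct $i,j,k\in V$, $d_{(0i)}\ge0$ for all $i\in V$, and $d_{(ij)}+d_{(0j)}-d_{(0i)}\ge0$ and $d_{(ij)}+d_{(0i)}-d_{(0j)}\ge0$ for all distinct $i,j\in V$. For $k\in V$ let $q(k)=\sum_{j\in V\setminus\{k\}}(e_{kj}-e_{jk})\in{\mathbb R}^{E^{\cal O}}$. Let $Q_n\subset{\mathbb R}^{E^{\cal O}}$ be the subspace spanned by all $e_{ij}+e_{ji}$, $(ij)\in E$, and all $q(k)$, $k\in V$. The map $\psi:{\mathbb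 R}^{E\cup E_0}\to Q_n$ is the linear map with $\psi(e_{(ij)})=e_{ij}+e_{ji}$ for $(ij)\in E$ and $\psi(e_{(0i)})=q(i)$ for $i\in V$. The cone $QMet_n\subset{\mathbb R}^{E^{\cal O}}$ of quasi-metrics consists of all $q$ with $q_{ij}\ge0$ for all $ij\in E^{\cal O}$ and $q_{ij}+q_{jk}-q_{ik}\ge0$ for all ordered triples $ijk$ of distinct elements of $V$. The cone of weighted quasi-metrics is $WQMet_n=QMet_n\cap Q_n$. For $q\in{\mathbb R}^{E^{\cal O}}$, $q^*$ is defined by $q^*_{ij}=q_{ji}$, and for a set $A$, $A^*=\{q^*:q\in A\}$. *)

theory Defs
  imports "HOL-Analysis.Finite_Function_Topology"
begin

(* The coordinate space R^S is the subspace of the real vector space of finitely supported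
   functions whose members are supported in S; S need not exhaust its type. *)

definition coord_space :: "'b set \<Rightarrow> ('b \<Rightarrow>\<^sub>0 real) set" where
  "coord_space S = {x. Poly_Mapping.keys x \<subseteq> S}"

abbreviation basis_vec :: "'b \<Rightarrow> ('b \<Rightarrow>\<^sub>0 real)" where
  "basis_vec s \<equiv> Poly_Mapping.single s 1"

abbreviation coord :: "('b \<Rightarrow>\<^sub>0 real) \<Rightarrow> 'b \<Rightarrow> real" where
  "coord \<equiv> Poly_Mapping.lookup"

(* An unordered pair (ij) is the set {i, j}, an ordered pair ij is the tuple (i, j).
   The extra point 0 is the parameter z, to be taken outside V. *)

definition edges :: "'a set \<Rightarrow> 'a set set" where
  "edges V = {{i, j} |i j. i \<in> V \<and> j \<in> V \<and> i \<noteq> j}"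

definition edges0 :: "'a set \<Rightarrow> 'a \<Rightarrow> 'a set set" where
  "edges0 V z = {{z, i} |i. i \<in> V}"

definition arcs :: "'a set \<Rightarrow> ('a \<times> 'a) set" where
  "arcs V = {(i, j). i \<in> V \<and> j \<in> V \<and> i \<noteq> j}"

definition Met :: "'a set \<Rightarrow> 'a \<Rightarrow> ('a set \<Rightarrow>\<^sub>0 real) set" where
  "Met V z = {d \<in> coord_space (edges V \<union> edges0 V z).
     \<forall>i\<in>insert z V. \<forall>j\<in>insert z V. \<forall>k\<in>insert z V. distinct [i, j, k] \<longrightarrow>
       coord d {i, j} + coord d {j, k} - coord d {i, k} \<ge> 0}"

definition dWMet :: "'a set \<Rightarrow> 'a \<Rightarrow> ('a set \<Rightarrow>\<^sub>0 real) set" where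
  "dWMet V z = {d \<in> coord_space (edges V \<union> edges0 V z).
     (\<forall>i\<in>V. \<forall>j\<in>V. \<forall>k\<in>V. distinct [i, j, k] \<longrightarrow>
        coord d {i, k} + coord d {k, j} - coord d {i, j} \<ge> 0) \<and>
     (\<forall>i\<in>V. coord d {z, i} \<ge> 0) \<and>
     (\<forall>i\<in>V. \<forall>j\<in>V. i \<noteq> j \<longrightarrow>
        coord d {i, j} + coord d {z, j} - coord d {z, i} \<ge> 0 \<and>
        coord d {i, j} + coord d {z, i} - coord d {z, j} \<ge> 0)}"

definition q_vec :: "'a set \<Rightarrow> 'a \<Rightarrow> ('a \<times> 'a \<Rightarrow>\<^sub>0 real)" where
  "q_vec V k = (\<Sum>j\<in>V - {k}. basis_vec (k, j) - basis_vec (j, k))"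

definition Q_space :: "'a set \<Rightarrow> ('a \<times> 'a \<Rightarrow>\<^sub>0 real) set" where
  "Q_space V = span ({basis_vec (i, j) + basis_vec (j, i) |i j. i \<in> V \<and> j \<in> V \<and> i \<noteq> j}
                     \<union> {q_vec V k |k. k \<in> V})"

(* The two ordered pairs over an edge x = {i, j} are (i, j) and (j, i), so the first inner sum
   is basis_vec (i, j) + basis_vec (j, i).  That psi is the linear map with the prescribed
   values on the basis is established in linear_psi, psi_edge, psi_edge0 and psi_unique. *)

definition psi :: "'a set \<Rightarrow> 'a \<Rightarrow> ('a set \<Rightarrow>\<^sub>0 real) \<Rightarrow> ('a \<times> 'a \<Rightarrow>\<^sub>0 real)" where
  "psi V z d =
     (\<Sum>x\<in>edges V. coord d x *\<^sub>R (\<Sum>(i, j)\<in>{(i, j) \<in> arcs V. {i, j} = x}. basis_vec (i, j))) +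
     (\<Sum>i\<in>V. coord d {z, i} *\<^sub>R q_vec V i)"

definition QMet :: "'a set \<Rightarrow> ('a \<times> 'a \<Rightarrow>\<^sub>0 real) set" where
  "QMet V = {q \<in> coord_space (arcs V).
     (\<forall>(i, j)\<in>arcs V. coord q (i, j) \<ge> 0) \<and>
     (\<forall>i\<in>V. \<forall>j\<in>V. \<forall>k\<in>V. distinct [i, j, k] \<longrightarrow>
        coord q (i, j) + coord q (j, k) - coord q (i, k) \<ge> 0)}"

definition WQMet :: "'a set \<Rightarrow> ('a \<times> 'a \<Rightarrow>\<^sub>0 real) set" where
  "WQMet V = QMet V \<inter> Q_space V"

definition star :: "('a \<times> 'a \<Rightarrow>\<^sub>0 real) \<Rightarrow> ('a \<times> 'a \<Rightarrow>\<^sub>0 real)" where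
  "star q = Poly_Mapping.map_key prod.swap q"

lemma coord_star [simp]: "coord (star q) (i, j) = coord q (j, i)"
  by (simp add: star_def map_key.rep_eq)

lemma coord_scaleR [simp]: "coord (r *\<^sub>R x) s = r * coord x s"
  by (simp add: scaleR_poly_mapping_def Abs_poly_mapping_inverse)

lemma finite_edges: "finite V \<Longrightarrow> finite (edges V)"
  by (rule finite_subset[of _ "Pow V"]) (auto simp: edges_def)

lemma linear_psi: "linear (psi V z)"
  by (rule linearI)
    (simp_all add: psi_def lookup_add scaleR_add_left sum.distrib scaleR_add_right
       scaleR_sum_right del: scaleR_sum_left)

lemma arcs_over_edge:
  assumes "i \<in> V" "j \<in> V" "i \<noteq> j"
  shows "{(k, l) \<in> arcs V. {k, l} = {i, j}} = {(i, j), (j, i)}"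
  using assms by (auto simp: arcs_def doubleton_eq_iff)

lemma psi_edge:
  assumes "finite V" "z \<notin> V" "i \<in> V" "j \<in> V" "i \<noteq> j"
  shows "psi V z (basis_vec {i, j}) = basis_vec (i, j) + basis_vec (j, i)"
proof -
  let ?g = "\<lambda>x. \<Sum>(k, l)\<in>{(k, l) \<in> arcs V. {k, l} = x}. basis_vec (k, l)"
  have "coord (basis_vec {i, j}) {z, k} = 0" if "k \<in> V" for k
    using assms by (auto simp: lookup_single when_def doubleton_eq_iff)
  hence "psi V z (basis_vec {i, j}) = (\<Sum>x\<in>edges V. coord (basis_vec {i, j}) x *\<^sub>R ?g x)"
    by (simp add: psi_def)
  also have "\<dots> = (\<Sum>x\<in>edges V. if x = {i, j} then ?g x else 0)"
    by (rule sum.cong) (auto simp: lookup_single when_def)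
  also have "\<dots> = ?g {i, j}"
    using assms finite_edges[OF assms(1)] by (subst sum.delta) (simp_all, auto simp: edges_def)
  also have "\<dots> = basis_vec (i, j) + basis_vec (j, i)"
    using assms by (subst arcs_over_edge) auto
  finally show ?thesis .
qed

lemma psi_edge0:
  assumes "finite V" "z \<notin> V" "i \<in> V"
  shows "psi V z (basis_vec {z, i}) = q_vec V i"
proof -
  have "coord (basis_vec {z, i}) x = 0" if "x \<in> edges V" for x
    using that assms by (auto simp: lookup_single when_def edges_def doubleton_eq_iff)
  hence "psi V z (basis_vec {z, i}) = (\<Sum>k\<in>V. coord (basis_vec {z, i}) {z, k} *\<^sub>R q_vec V k)"
    by (simp add: psi_def)
  also have "\<dots> = (\<Sum>k\<in>V. if k = i then q_vec V k else 0)"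
    using assms by (intro sum.cong) (auto simp: lookup_single when_def doubleton_eq_iff)
  also have "\<dots> = q_vec V i"
    using assms by simp
  finally show ?thesis .
qed

lemma coord_space_expand:
  assumes "finite S" "x \<in> coord_space S"
  shows "x = (\<Sum>s\<in>S. coord x s *\<^sub>R basis_vec s)"
proof (rule poly_mapping_eqI)
  fix t
  have "coord (\<Sum>s\<in>S. coord x s *\<^sub>R basis_vec s) t = (\<Sum>s\<in>S. if s = t then coord x s else 0)"
    by (simp add: lookup_sum lookup_single when_def if_distrib cong: if_cong)
  also have "\<dots> = coord x t"
    using assms by (auto simp: coord_space_def in_keys_iff)
  finally show "coord x t = coord (\<Sum>s\<in>S. coord x s *\<^sub>R basis_vec s) t" ..
qed

lemma psi_unique:
  assumes V: "finite V" "z \<notin> V" and f: "linear f"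
    and e: "\<And>i j. i \<in> V \<Longrightarrow> j \<in> V \<Longrightarrow> i \<noteq> j \<Longrightarrow>
              f (basis_vec {i, j}) = basis_vec (i, j) + basis_vec (j, i)"
    and e0: "\<And>i. i \<in> V \<Longrightarrow> f (basis_vec {z, i}) = q_vec V i"
    and d: "d \<in> coord_space (edges V \<union> edges0 V z)"
  shows "f d = psi V z d"
proof -
  let ?S = "edges V \<union> edges0 V z"
  have "finite ?S"
    using V finite_edges by (auto simp: edges0_def)
  hence *: "g d = (\<Sum>x\<in>?S. coord d x *\<^sub>R g (basis_vec x))"
    if "linear g" for g :: "('a set \<Rightarrow>\<^sub>0 real) \<Rightarrow> ('a \<times> 'a \<Rightarrow>\<^sub>0 real)"
    using arg_cong[OF coord_space_expand[OF _ d], of g] that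
    by (simp add: linear_sum linear_cmul)
  have "f (basis_vec x) = psi V z (basis_vec x)" if "x \<in> ?S" for x
    using that V e e0 by (auto simp: edges_def edges0_def psi_edge psi_edge0)
  thus ?thesis
    by (simp add: *[OF f] *[OF linear_psi])
qed

lemma psi_in_Q_space: "psi V z d \<in> Q_space V"
proof -
  have "(\<Sum>(i, j)\<in>{(i, j) \<in> arcs V. {i, j} = x}. basis_vec (i, j)) \<in> Q_space V"
    if "x \<in> edges V" for x
  proof -
    from that obtain i j where "i \<in> V" "j \<in> V" "i \<noteq> j" "x = {i, j}"
      by (auto simp: edges_def)
    thus ?thesis
      by (simp add: arcs_over_edge Q_space_def) (rule span_base, blast)
  qed
  moreover have "q_vec V i \<in> Q_space V" if "i \<in> V" for i
    using that unfolding Q_space_def by (intro span_base) blast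
  moreover have "subspace (Q_space V)"
    by (simp add: Q_space_def)
  ultimately show ?thesis
    unfolding psi_def
    by (auto intro!: subspace_add[of "Q_space V"] subspace_sum[of "Q_space V" "edges V"]
        subspace_sum[of "Q_space V" V] subspace_scale[of "Q_space V"])
qed

end

(* In coordinates, psi sends d to the quasi-metric q_ij = d_ij + w_i - w_j with weights w_i = d_0i.
   The weights cancel in the directed triangle inequalities, and q >= 0 says |w_i - w_j| <= d_ij, so
   both cones are mapped into WQMet.  Conversely the q(k) sum to zero, so adding a constant to all
   weights of a preimage does not change its image; for a large constant the preimage satisfies
   w_i >= 0 and w_i + w_j >= d_ij and hence lies in both cones. *)

theory Submission
  imports Defs
begin

section \<open>Coordinates of the vectors q(k) and of psi\<close>

lemma in_coord_space_iff: "x \<in> coord_space S \<longleftrightarrow> (\<forall>s. s \<notin> S \<longrightarrow> coord x s = 0)"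
  by (auto simp: coord_space_def in_keys_iff)

lemma subspace_coord_space: "subspace (coord_space S)"
  by (auto simp: subspace_def in_coord_space_iff lookup_add)

lemma coord_q_vec:
  assumes "finite V" "i \<in> V" "j \<in> V" "i \<noteq> j"
  shows "coord (q_vec V k) (i, j) = (if k = i then 1 else 0) - (if k = j then 1 else 0)"
proof -
  \<comment> \<open>The summand for l meets the arc (i, j) only with its outgoing arc, when k = i
    and l = j, or with its incoming arc, when k = j and l = i.\<close>
  have "coord (q_vec V k) (i, j) =
      (\<Sum>l\<in>V - {k}. (if l = j then if k = i then 1 else 0 else 0)
                 - (if l = i then if k = j then 1 else 0 else 0))"
    unfolding q_vec_def lookup_sum
    by (rule sum.cong) (auto simp: lookup_minus lookup_single when_def)
  also have "\<dots> = (if k = i then 1 else 0) - (if k = j then 1 else 0)"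
    using assms by (simp add: sum_subtractf)
  finally show ?thesis .
qed

lemma coord_q_vec_off_arcs:
  assumes "k \<in> V" "(i, j) \<notin> arcs V"
  shows "coord (q_vec V k) (i, j) = 0"
  unfolding q_vec_def lookup_sum
proof (rule sum.neutral, rule ballI)
  fix l assume "l \<in> V - {k}"
  hence "(k, l) \<noteq> (i, j)" "(l, k) \<noteq> (i, j)"
    using assms by (auto simp: arcs_def)
  thus "coord (basis_vec (k, l) - basis_vec (l, k)) (i, j) = 0"
    by (simp only: lookup_minus lookup_single_not_eq diff_self not_False_eq_True)
qed

lemma finite_arcs: "finite V \<Longrightarrow> finite (arcs V)"
  by (rule finite_subset[of _ "V \<times> V"]) (auto simp: arcs_def)

text \<open>Each arc lies over exactly one edge, so in the sum over \<open>edges V\<close> that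
  defines \<open>psi\<close> only one term contributes to a given arc.\<close>

lemma coord_edge_sum:
  assumes "finite V"
  shows "coord (\<Sum>(k, l)\<in>{(k, l) \<in> arcs V. {k, l} = x}. basis_vec (k, l)) (i, j) =
    (if (i, j) \<in> arcs V \<and> x = {i, j} then 1 else 0)"
proof -
  let ?A = "{(k, l) \<in> arcs V. {k, l} = x}"
  have "finite ?A"
    by (rule finite_subset[OF _ finite_arcs[OF assms]]) auto
  moreover have "coord (\<Sum>(k, l)\<in>?A. basis_vec (k, l)) (i, j) = (\<Sum>a\<in>?A. if a = (i, j) then 1 else 0)"
    unfolding lookup_sum by (intro sum.cong refl) (simp add: lookup_single when_def split: prod.split)
  moreover have "(i, j) \<in> ?A \<longleftrightarrow> (i, j) \<in> arcs V \<and> x = {i, j}"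
    by auto
  ultimately show ?thesis
    by (simp only: sum.delta)
qed

lemma coord_sum_scaleR:
  "coord (\<Sum>x\<in>A. c x *\<^sub>R f x) s = (\<Sum>x\<in>A. c x * coord (f x) s)"
  by (simp add: lookup_sum)

text \<open>Of all the q(k), just q(i) and q(j) have a nonzero coordinate at (i, j), with opposite
  signs, so the weights enter only through their difference.\<close>

lemma coord_psi:
  assumes "finite V" "i \<in> V" "j \<in> V" "i \<noteq> j"
  shows "coord (psi V z d) (i, j) = coord d {i, j} + coord d {z, i} - coord d {z, j}"
proof -
  have arc: "(i, j) \<in> arcs V" and edge: "{i, j} \<in> edges V"
    using assms by (auto simp: arcs_def edges_def)
  have "(\<Sum>x\<in>edges V. coord d x * (if x = {i, j} then 1 else 0)) = coord d {i, j}"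
    using edge finite_edges[OF assms(1)] by (simp add: if_distrib cong: if_cong)
  moreover have "(\<Sum>k\<in>V. coord d {z, k} * ((if k = i then 1 else 0) - (if k = j then 1 else 0)))
      = coord d {z, i} - coord d {z, j}"
    using assms by (simp add: right_diff_distrib sum_subtractf
        if_distrib[where f = "(*) c" for c] cong: if_cong)
  ultimately show ?thesis
    unfolding psi_def lookup_add coord_sum_scaleR coord_edge_sum[OF assms(1)] coord_q_vec[OF assms]
    using arc by simp
qed

lemma psi_in_coord_space:
  assumes "finite V"
  shows "psi V z d \<in> coord_space (arcs V)"
  unfolding in_coord_space_iff split_paired_All psi_def lookup_add coord_sum_scaleR
    coord_edge_sum[OF assms]
  by (simp add: coord_q_vec_off_arcs)

text \<open>Along a directed triangle the weights telescope, which leaves the undirected triangle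
  inequality on V; the weights matter only for nonnegativity. The equivalence serves both to bound
  the images of the cones and to extract inequalities from a given quasi-metric.\<close>

lemma psi_in_QMet_iff:
  assumes "finite V"
  shows "psi V z d \<in> QMet V \<longleftrightarrow>
    (\<forall>i\<in>V. \<forall>j\<in>V. i \<noteq> j \<longrightarrow> coord d {i, j} + coord d {z, i} - coord d {z, j} \<ge> 0) \<and>
    (\<forall>i\<in>V. \<forall>j\<in>V. \<forall>k\<in>V. distinct [i, j, k] \<longrightarrow>
       coord d {i, j} + coord d {j, k} - coord d {i, k} \<ge> 0)"
proof -
  let ?q = "coord (psi V z d)"
  have "(\<forall>(i, j)\<in>arcs V. ?q (i, j) \<ge> 0) \<longleftrightarrow> (\<forall>i\<in>V. \<forall>j\<in>V. i \<noteq> j \<longrightarrow> ?q (i, j) \<ge> 0)"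
    unfolding arcs_def by blast
  also have "\<dots> \<longleftrightarrow>
    (\<forall>i\<in>V. \<forall>j\<in>V. i \<noteq> j \<longrightarrow> coord d {i, j} + coord d {z, i} - coord d {z, j} \<ge> 0)"
    by (intro ball_cong imp_cong refl) (simp only: coord_psi[OF assms] not_False_eq_True)
  finally have nonneg: "(\<forall>(i, j)\<in>arcs V. ?q (i, j) \<ge> 0) \<longleftrightarrow> \<dots>" .
  have "?q (i, j) + ?q (j, k) - ?q (i, k) = coord d {i, j} + coord d {j, k} - coord d {i, k}"
    if "i \<in> V" "j \<in> V" "k \<in> V" "distinct [i, j, k]" for i j k
    using that by (simp add: coord_psi[OF assms])
  hence tri: "(\<forall>i\<in>V. \<forall>j\<in>V. \<forall>k\<in>V. distinct [i, j, k] \<longrightarrow>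
       ?q (i, j) + ?q (j, k) - ?q (i, k) \<ge> 0) \<longleftrightarrow>
    (\<forall>i\<in>V. \<forall>j\<in>V. \<forall>k\<in>V. distinct [i, j, k] \<longrightarrow>
       coord d {i, j} + coord d {j, k} - coord d {i, k} \<ge> 0)"
    by (intro ball_cong imp_cong refl) (simp only:)
  show ?thesis
    unfolding QMet_def mem_Collect_eq nonneg tri
    by (simp only: psi_in_coord_space[OF assms] simp_thms)
qed

section \<open>The images of the two cones consist of weighted quasi-metrics\<close>

lemma psi_image_Met:
  assumes "finite V" "z \<notin> V"
  shows "psi V z ` Met V z \<subseteq> WQMet V"
proof
  fix q assume "q \<in> psi V z ` Met V z"
  then obtain d where q: "q = psi V z d" and d: "d \<in> Met V z" by blast
  have tri: "coord d {i, j} + coord d {j, k} - coord d {i, k} \<ge> 0"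
    if "i \<in> insert z V" "j \<in> insert z V" "k \<in> insert z V" "distinct [i, j, k]" for i j k
    using d that unfolding Met_def by blast
  \<comment> \<open>Nonnegativity on the arc (i, j) is the triangle inequality along z, i,
    j.\<close>
  have "coord d {i, j} + coord d {z, i} - coord d {z, j} \<ge> 0" if "i \<in> V" "j \<in> V" "i \<noteq> j" for i j
    using tri[of z i j] that assms(2) by (auto simp: add.commute)
  thus "q \<in> WQMet V"
    using tri by (simp add: q WQMet_def psi_in_Q_space psi_in_QMet_iff[OF assms(1)])
qed

lemma psi_image_dWMet:
  assumes "finite V"
  shows "psi V z ` dWMet V z \<subseteq> WQMet V"
proof
  fix q assume "q \<in> psi V z ` dWMet V z"
  then obtain d where q: "q = psi V z d" and d: "d \<in> dWMet V z" by blast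
  have "coord d {i, j} + coord d {j, k} - coord d {i, k} \<ge> 0"
    if "i \<in> V" "j \<in> V" "k \<in> V" "distinct [i, j, k]" for i j k
  proof -
    \<comment> \<open>\<open>dWMet\<close> names the middle vertex last, so its condition is
      instantiated with j and k exchanged.\<close>
    have "distinct [i, k, j]"
      using that by auto
    with that d show ?thesis
      unfolding dWMet_def by blast
  qed
  moreover have "coord d {i, j} + coord d {z, i} - coord d {z, j} \<ge> 0"
    if "i \<in> V" "j \<in> V" "i \<noteq> j" for i j
    using d that unfolding dWMet_def by blast
  ultimately show "q \<in> WQMet V"
    by (simp add: q WQMet_def psi_in_Q_space psi_in_QMet_iff[OF assms])
qed

section \<open>Preimages of weighted quasi-metrics\<close>

lemma Q_space_subset_psi_image:
  assumes "finite V" "z \<notin> V"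
  shows "Q_space V \<subseteq> psi V z ` coord_space (edges V \<union> edges0 V z)"
  unfolding Q_space_def
\<comment> \<open>The image of a subspace under a linear map is a subspace, and the generators of
  \<open>Q_space V\<close> are the images of basis vectors.\<close>
proof (rule span_minimal)
  let ?S = "edges V \<union> edges0 V z"
  have "basis_vec s \<in> coord_space ?S" if "s \<in> ?S" for s
    using that by (simp add: coord_space_def)
  hence img: "psi V z (basis_vec s) \<in> psi V z ` coord_space ?S" if "s \<in> ?S" for s
    using that by blast
  have "basis_vec (i, j) + basis_vec (j, i) \<in> psi V z ` coord_space ?S"
    if "i \<in> V" "j \<in> V" "i \<noteq> j" for i j
    using img[of "{i, j}"] that psi_edge[OF assms that] by (auto simp: edges_def)
  moreover have "q_vec V k \<in> psi V z ` coord_space ?S" if "k \<in> V" for k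
    using img[of "{z, k}"] that psi_edge0[OF assms that] by (auto simp: edges0_def)
  ultimately show "{basis_vec (i, j) + basis_vec (j, i) |i j. i \<in> V \<and> j \<in> V \<and> i \<noteq> j}
      \<union> {q_vec V k |k. k \<in> V} \<subseteq> psi V z ` coord_space ?S"
    by blast
  show "subspace (psi V z ` coord_space ?S)"
    by (rule linear_subspace_image[OF linear_psi subspace_coord_space])
qed

text \<open>Beyond what the quasi-metric itself dictates, \<open>dWMet\<close> asks for nonnegative
  weights and \<open>Met\<close> for triangle inequalities through z. Raising all weights by one
  large constant achieves both at once.\<close>

lemma WQMet_preimage_in_both_cones:
  assumes "finite V" "z \<notin> V" "q \<in> WQMet V"
  obtains d where "q = psi V z d" "d \<in> Met V z" "d \<in> dWMet V z"
proof -
  let ?S = "edges V \<union> edges0 V z"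
  obtain d where q: "q = psi V z d" and d: "d \<in> coord_space ?S"
    using assms Q_space_subset_psi_image[OF assms(1,2)] by (auto simp: WQMet_def)
  \<comment> \<open>With c twice the sum of all absolute values, each coordinate on
    \<open>?S\<close> has absolute value at most c/2. This gives w_i + c \<ge> 0 and, as three such
    terms amount to at most 3c/2, also w_i + w_j + 2c \<ge> d_ij.\<close>
  define c where "c = (\<Sum>x\<in>?S. \<bar>coord d x\<bar>) * 2"
  have fin: "finite ?S"
    using assms finite_edges by (auto simp: edges0_def)
  have bound: "2 * \<bar>coord d x\<bar> \<le> c" if "x \<in> ?S" for x
    using member_le_sum[OF that, of "\<lambda>x. \<bar>coord d x\<bar>"] fin by (simp add: c_def)
  define d' where "d' = d + c *\<^sub>R (\<Sum>i\<in>V. basis_vec {z, i})"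
  have weight: "coord d' {z, i} = coord d {z, i} + c" if "i \<in> V" for i
  proof -
    have "coord (\<Sum>k\<in>V. basis_vec {z, k}) {z, i} = (\<Sum>k\<in>V. if k = i then 1 else (0::real))"
      unfolding lookup_sum using that assms(2)
      by (intro sum.cong) (auto simp: lookup_single when_def doubleton_eq_iff)
    thus ?thesis
      using that assms(1) by (simp add: d'_def lookup_add)
  qed
  have dist: "coord d' {i, j} = coord d {i, j}" if "i \<in> V" "j \<in> V" for i j
  proof -
    have "coord (\<Sum>k\<in>V. basis_vec {z, k}) {i, j} = (0::real)"
      unfolding lookup_sum using that assms(2)
      by (intro sum.neutral) (auto simp: lookup_single when_def doubleton_eq_iff)
    thus ?thesis
      by (simp add: d'_def lookup_add)
  qed
  have basis: "basis_vec {z, i} \<in> coord_space ?S" if "i \<in> V" for i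
    using that by (auto simp: coord_space_def edges0_def)
  have d'S: "d' \<in> coord_space ?S"
    unfolding d'_def
    by (intro subspace_add subspace_scale subspace_sum subspace_coord_space d basis)
  \<comment> \<open>On arcs c cancels in the difference of the weights; off \<open>arcs V\<close>
    both sides vanish.\<close>
  have q': "q = psi V z d'"
  proof (rule poly_mapping_eqI)
    fix a :: "'a \<times> 'a"
    obtain i j where a: "a = (i, j)" by (cases a)
    show "coord q a = coord (psi V z d') a"
    proof (cases "a \<in> arcs V")
      case True
      thus ?thesis
        using assms(1) by (simp add: a q arcs_def coord_psi weight dist)
    next
      case False
      thus ?thesis
        using psi_in_coord_space[OF assms(1)] by (simp add: a q in_coord_space_iff)
    qed
  qed
  \<comment> \<open>The inequalities for q are now read back as inequalities for
    \<open>d'\<close>.\<close>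
  have "psi V z d' \<in> QMet V"
    using assms(3) q' by (simp add: WQMet_def)
  note QMet = this[unfolded psi_in_QMet_iff[OF assms(1)]]
  have mono: "coord d' {i, j} + coord d' {z, i} - coord d' {z, j} \<ge> 0"
    if "i \<in> V" "j \<in> V" "i \<noteq> j" for i j
    using QMet that by blast
  have tri: "coord d' {i, j} + coord d' {j, k} - coord d' {i, k} \<ge> 0"
    if "i \<in> V" "j \<in> V" "k \<in> V" "distinct [i, j, k]" for i j k
    using QMet that by blast
  have edge0: "{z, i} \<in> ?S" if "i \<in> V" for i
    using that by (auto simp: edges0_def)
  have nonneg: "coord d' {z, i} \<ge> 0" if "i \<in> V" for i
    using bound[OF edge0[OF that]] weight[OF that] by linarith
  \<comment> \<open>With z as the middle vertex the weights add up instead of cancelling; q gives no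
    control here, and the size of c is needed.\<close>
  have up: "coord d' {i, z} + coord d' {z, j} - coord d' {i, j} \<ge> 0"
    if "i \<in> V" "j \<in> V" "i \<noteq> j" for i j
  proof -
    have "{i, j} \<in> ?S"
      using that by (auto simp: edges_def)
    from bound[OF this] bound[OF edge0[OF that(1)]] bound[OF edge0[OF that(2)]]
    show ?thesis
      using that weight dist by (simp add: insert_commute[of i z])
  qed
  have "d' \<in> dWMet V z"
    unfolding dWMet_def
  proof (intro CollectI conjI ballI impI)
    fix i j k assume "i \<in> V" "j \<in> V" "k \<in> V" "distinct [i, j, k]"
    thus "coord d' {i, k} + coord d' {k, j} - coord d' {i, j} \<ge> 0"
      using tri[of i k j] by auto
  next
    fix i j assume "i \<in> V" "j \<in> V" "i \<noteq> j"
    thus "coord d' {i, j} + coord d' {z, j} - coord d' {z, i} \<ge> 0"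
      using mono[of j i] by (simp add: insert_commute[of j i])
  qed (use d'S nonneg mono in auto)
  moreover have "d' \<in> Met V z"
    unfolding Met_def
  proof (intro CollectI conjI ballI impI)
    fix i j k assume mem: "i \<in> insert z V" "j \<in> insert z V" "k \<in> insert z V"
      and ne: "distinct [i, j, k]"
    \<comment> \<open>Distinctness lets z occur at most once: at an end the inequality is
      \<open>mono\<close>, in the middle \<open>up\<close>, and without z it is
      \<open>tri\<close>.\<close>
    consider "i = z" "j \<in> V" "k \<in> V" | "j = z" "i \<in> V" "k \<in> V" | "k = z" "i \<in> V" "j \<in> V"
      | "i \<in> V" "j \<in> V" "k \<in> V"
      using mem ne by auto
    thus "coord d' {i, j} + coord d' {j, k} - coord d' {i, k} \<ge> 0"
    proof cases
      case 1
      thus ?thesis using mono[of j k] ne by simp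
    next
      case 2
      thus ?thesis using up[of i k] ne by simp
    next
      case 3
      thus ?thesis using mono[of j i] ne
        by (auto simp: insert_commute[of j i] insert_commute[of z i] insert_commute[of z j])
    next
      case 4
      thus ?thesis using tri ne by blast
    qed
  qed (rule d'S)
  ultimately show thesis
    using that q' by blast
qed

section \<open>Invariance under reversal of arcs\<close>

lemma linear_star: "linear star"
  by (rule linearI; rule poly_mapping_eqI; clarsimp simp: lookup_add)

lemma star_star [simp]: "star (star q) = q"
  by (rule poly_mapping_eqI) clarsimp

lemma star_basis_vec: "star (basis_vec (i, j)) = basis_vec (j, i)"
  by (rule poly_mapping_eqI) (auto simp: lookup_single when_def split: if_splits)

text \<open>Reversal exchanges the outgoing and incoming arcs at k, which carry opposite
  signs.\<close>

lemma star_q_vec: "star (q_vec V k) = - q_vec V k"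
  by (simp add: q_vec_def linear_sum[OF linear_star] linear_diff[OF linear_star] star_basis_vec
      flip: sum_negf)

text \<open>By linearity the generators suffice: the symmetric ones are fixed and the q(k) are
  negated, so all stay in the span.\<close>

lemma star_Q_space: "star ` Q_space V \<subseteq> Q_space V"
proof -
  let ?B = "{basis_vec (i, j) + basis_vec (j, i) |i j. i \<in> V \<and> j \<in> V \<and> i \<noteq> j}
            \<union> {q_vec V k |k. k \<in> V}"
  have "star b \<in> span ?B" if "b \<in> ?B" for b
    using that
  proof
    assume "b \<in> {basis_vec (i, j) + basis_vec (j, i) |i j. i \<in> V \<and> j \<in> V \<and> i \<noteq> j}"
    hence "star b = b"
      by (auto simp: linear_add[OF linear_star] star_basis_vec add.commute)
    thus ?thesis
      using span_base[OF that] by simp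
  next
    assume "b \<in> {q_vec V k |k. k \<in> V}"
    hence "star b = - b"
      by (auto simp: star_q_vec)
    thus ?thesis
      using span_neg[OF span_base[OF that]] by simp
  qed
  hence "span (star ` ?B) \<subseteq> span ?B"
    by (intro span_minimal subspace_span) blast
  thus ?thesis
    unfolding Q_space_def by (simp only: linear_span_image[OF linear_star])
qed

lemma star_QMet:
  assumes "q \<in> QMet V"
  shows "star q \<in> QMet V"
proof -
  \<comment> \<open>The triangle inequality of \<open>star q\<close> along i, j, k is that of q
    along k, j, i.\<close>
  have "coord q (k, j) + coord q (j, i) - coord q (k, i) \<ge> 0"
    if "i \<in> V" "j \<in> V" "k \<in> V" "distinct [i, j, k]" for i j k
    using assms that by (auto simp: QMet_def)
  thus ?thesis
    using assms by (auto simp: QMet_def in_coord_space_iff arcs_def add.commute)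
qed

lemma star_WQMet: "star ` WQMet V = WQMet V"
proof
  show sub: "star ` WQMet V \<subseteq> WQMet V"
    using star_QMet star_Q_space by (fastforce simp: WQMet_def)
  \<comment> \<open>As \<open>star\<close> is an involution, the first inclusion already yields the
    reverse one.\<close>
  show "WQMet V \<subseteq> star ` WQMet V"
    using sub by (metis image_subset_iff rev_image_eqI star_star subsetI)
qed

theorem theorem4:
  fixes V :: "'a set" and z :: 'a
  assumes "finite V" and "z \<notin> V"
  shows "psi V z ` Met V z = psi V z ` dWMet V z \<and>
         psi V z ` dWMet V z = WQMet V \<and>
         star ` WQMet V = WQMet V"
proof -
  have "WQMet V \<subseteq> psi V z ` Met V z" "WQMet V \<subseteq> psi V z ` dWMet V z"
    using WQMet_preimage_in_both_cones[OF assms] by (metis imageI subsetI)+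
  thus ?thesis
    using psi_image_Met[OF assms] psi_image_dWMet[OF assms(1)] star_WQMet by blast
qed

end
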